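(* Let $1\le p\le 2$, let $n, N\ge 1$ be integers, and let $P_1,\dots,P_n$ be homogeneous polynomials on the complex space $\ell_p^N$ of degrees $k_1,\dots,k_n$ respectively. If $\mathbf k=k_1+\cdots+k_n$, then $$\|P_1\cdots P_n\|_{\mathcal P(^{\mathbf k}\ell^N_p)} \ge \left(\frac{\prod_{i=1}^{n} k_i^{k_i}}{\mathbf k^{\mathbf k}}\right)^{1/p} \|P_1\|_{\mathcal P(^{k_1}\ell_p^N)} \cdots \|P_n\|_{\mathcal P(^{k_n}\ell_p^N)}.$$ Moreover, the constant $\left(\prod_{i=1}^{n} k_i^{k_i}/\mathbf k^{\mathbf k}\right)^{1/p}$ is optimal provided that $N\ge n$.
   Context: $\ell_p^N$ denotes $\mathbb C^N$ with the norm $\|\cdot\|_p$. For a complex Banach space $X$ and an integer $k\ge 1$, a continuous $k$-homogeneous polynomial (homogeneous polynomial of degree $k$) on $X$ is a map $P:X\to\mathbb C$ for which there is a continuous $k$-linear map $T:X\times\cdots\times X\to\mathbb C$ with $P(x)=T(x,\dots,x)$ for all $x\in X$. The space $\mathcal P(^kX)$ of such maps carries the norm $\|P\|_{\mathcal P(^kX)}=\sup_{\|z\|_X=1}|P(z)|$. The product $P_1\cdots P_n$ is the pointwise product. "The constant is optimal" means that, for the given degrees $k_1,\dots,k_n$, the inequality for all homogeneous polynomials $P_1,\dots,P_n$ of these degrees on the space fails if the constant is replaced by any larger one. *)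

theory Defs
  imports "HOL-Analysis.Analysis"
begin

definition lp_norm :: "real \<Rightarrow> complex ^ 'N \<Rightarrow> real" where
  "lp_norm p x = (\<Sum>j\<in>UNIV. cmod (x $ j) powr p) powr (1 / p)"

(* The k-fold product X x ... x X is the set of extensional functions on {..<k}.
   Linearity is over the complex numbers: *s is the complex scalar multiplication on
   complex ^ 'N, whereas the library's plain "linear" is only real-linear.
   Continuity refers to the usual topology of complex ^ 'N, which is the one induced by
   every norm on this finite-dimensional space, in particular by each lp_norm p. *)
definition continuous_multilinear ::
    "nat \<Rightarrow> ((nat \<Rightarrow> complex ^ 'N) \<Rightarrow> complex) \<Rightarrow> bool" where
  "continuous_multilinear k T \<longleftrightarrow>
     (\<forall>x \<in> {..<k} \<rightarrow>\<^sub>E UNIV. \<forall>i<k. Vector_Spaces.linear (*s) (*) (\<lambda>v. T (x(i := v)))) \<and>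
     continuous_map (product_topology (\<lambda>_. euclidean) {..<k}) euclidean T"

definition homogeneous_polynomial :: "nat \<Rightarrow> (complex ^ 'N \<Rightarrow> complex) \<Rightarrow> bool" where
  "homogeneous_polynomial k P \<longleftrightarrow>
     (\<exists>T. continuous_multilinear k T \<and> (\<forall>x. P x = T (\<lambda>i\<in>{..<k}. x)))"

definition poly_norm :: "real \<Rightarrow> (complex ^ 'N \<Rightarrow> complex) \<Rightarrow> real" where
  "poly_norm p P = (SUP z\<in>{z. lp_norm p z = 1}. cmod (P z))"

definition product_const :: "real \<Rightarrow> nat \<Rightarrow> (nat \<Rightarrow> nat) \<Rightarrow> real" where
  "product_const p n k =
     ((\<Prod>i=1..n. real (k i) ^ k i) / real (\<Sum>i=1..n. k i) ^ (\<Sum>i=1..n. k i)) powr (1 / p)"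

end

(* Let P_i attain its norm at z_i on the unit sphere, and put y_j = r_j z_j with r_j^p = k_j / K,
   where K is the sum of the degrees. For unimodular t_j and x = \<Sum>j. t_j y_j, let u_c and a_{jc} be
   the coordinates of x and y_j, and let S_c = \<Sum>j. |a_{jc}|^2. As p <= 2, the tangent to the concave
   function s^(p/2) at S_c bounds |u_c|^p by S_c^(p/2) plus a multiple of |u_c|^2 - S_c, which
   contains only the cross terms t_j cnj(t_l), j \<noteq> l; and \<Sum>c. S_c^(p/2) <= \<Sum>j. r_j^p = 1.
   Hence |\<Prod>i. P_i(x)| <= ||\<Prod>i. P_i|| exp(h(t)) with h a combination of such cross terms.
   In each single variable t_m, h is a constant plus Re(b t_m), so the maximum principle for
   F(t) e^(-b t) removes t_m from the estimate. Once all variables are removed, what remains is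
   \<Prod>i. r_i^(k_i) |P_i(z_i)| <= ||\<Prod>i. P_i||. Powers of distinct coordinates attain equality. *)

theory Submission
  imports Defs "HOL-Complex_Analysis.Conformal_Mappings"
begin

section \<open>Homogeneous polynomials: scaling, holomorphy on complex lines, continuity, coordinate
  powers\<close>

lemma homogeneous_polynomial_scale:
  assumes "homogeneous_polynomial k P"
  shows "P (c *s x) = c ^ k * P x"
proof -
  obtain T where T: "\<And>x i. x \<in> {..<k} \<rightarrow>\<^sub>E UNIV \<Longrightarrow> i < k \<Longrightarrow>
        Vector_Spaces.linear (*s) (*) (\<lambda>v. T (x(i := v)))"
    and P: "\<And>x. P x = T (\<lambda>i\<in>{..<k}. x)"
    using assms unfolding homogeneous_polynomial_def continuous_multilinear_def by blast
  \<comment> \<open>The slots of \<open>T\<close> are rescaled one at a time; each replacement pulls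
    out one factor \<open>c\<close> by linearity in that slot.\<close>
  have "T (\<lambda>i\<in>{..<k}. if i < m then c *s x else x) = c ^ m * P x" if "m \<le> k" for m
    using that
  proof (induction m)
    case 0
    then show ?case by (simp add: P restrict_def)
  next
    case (Suc m)
    let ?y = "\<lambda>i\<in>{..<k}. if i < m then c *s x else x"
    have "(\<lambda>i\<in>{..<k}. if i < Suc m then c *s x else x) = ?y(m := c *s x)"
      using Suc.prems by (auto simp: fun_eq_iff less_Suc_eq)
    moreover have "T (?y(m := c *s x)) = c * T (?y(m := x))"
    proof -
      interpret L: Vector_Spaces.linear "(*s)" "(*)" "\<lambda>v. T (?y(m := v))"
        using T[of ?y m] Suc.prems by simp
      show ?thesis by (rule L.scale)
    qed
    moreover have "?y(m := x) = ?y"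
      using Suc.prems by (auto simp: fun_eq_iff)
    moreover have "T ?y = c ^ m * P x"
      using Suc.prems by (intro Suc.IH) simp
    ultimately show ?case
      by (simp only: power_Suc mult.assoc)
  qed
  from this[of k] show ?thesis
    by (simp add: P cong: restrict_cong)
qed

lemma homogeneous_polynomial_line_holomorphic:
  assumes "homogeneous_polynomial k P"
  shows "(\<lambda>s. P (u + s *s w)) holomorphic_on S"
proof -
  obtain T where T: "\<And>x i. x \<in> {..<k} \<rightarrow>\<^sub>E UNIV \<Longrightarrow> i < k \<Longrightarrow>
        Vector_Spaces.linear (*s) (*) (\<lambda>v. T (x(i := v)))"
    and P: "\<And>x. P x = T (\<lambda>i\<in>{..<k}. x)"
    using assms unfolding homogeneous_polynomial_def continuous_multilinear_def by blast
  \<comment> \<open>The slots are filled from the left. The tail \<open>x\<close> is arbitrary so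
    that the induction hypothesis applies with slot \<open>m\<close> fixed at \<open>u\<close> or at
    \<open>w\<close>, the two values into which linearity splits that slot.\<close>
  have "(\<lambda>s. T (\<lambda>i\<in>{..<k}. if i < m then u + s *s w else x i)) holomorphic_on S"
    if "m \<le> k" for m x
    using that
  proof (induction m arbitrary: x)
    case 0
    then show ?case by simp
  next
    case (Suc m)
    let ?y = "\<lambda>s. \<lambda>i\<in>{..<k}. if i < m then u + s *s w else x i"
    have upd: "(?y s)(m := v) = (\<lambda>i\<in>{..<k}. if i < m then u + s *s w else (x(m := v)) i)" for s v
      using Suc.prems by (auto simp: fun_eq_iff)
    have "T (\<lambda>i\<in>{..<k}. if i < Suc m then u + s *s w else x i)
        = T ((?y s)(m := u)) + s * T ((?y s)(m := w))" for s
    proof -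
      have "(\<lambda>i\<in>{..<k}. if i < Suc m then u + s *s w else x i) = (?y s)(m := u + s *s w)"
        using Suc.prems by (auto simp: fun_eq_iff less_Suc_eq)
      moreover have "Vector_Spaces.linear (*s) (*) (\<lambda>v. T ((?y s)(m := v)))"
        using T[of "?y s" m] Suc.prems by simp
      then interpret L: Vector_Spaces.linear "(*s)" "(*)" "\<lambda>v. T ((?y s)(m := v))" .
      have "T ((?y s)(m := u + s *s w)) = T ((?y s)(m := u)) + s * T ((?y s)(m := w))"
        by (simp only: L.add L.scale)
      ultimately show ?thesis by simp
    qed
    moreover have "(\<lambda>s. T (\<lambda>i\<in>{..<k}. if i < m then u + s *s w else (x(m := v)) i)) holomorphic_on S" for v
      using Suc.prems by (intro Suc.IH) simp
    ultimately show ?case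
      unfolding upd by (simp only:) (intro holomorphic_intros)
  qed
  \<comment> \<open>Once all \<open>k\<close> slots are filled the tail is never read, so any value
    serves for it.\<close>
  from this[of k undefined] show ?thesis
    by (simp add: P cong: restrict_cong)
qed

lemma homogeneous_polynomial_continuous:
  assumes "homogeneous_polynomial k P"
  shows "continuous_on S P"
proof -
  obtain T where T: "continuous_map (product_topology (\<lambda>_. euclidean) {..<k}) euclidean T"
    and P: "\<And>x. P x = T (\<lambda>i\<in>{..<k}. x)"
    using assms unfolding homogeneous_polynomial_def continuous_multilinear_def by blast
  have "continuous_map euclidean (product_topology (\<lambda>_. euclidean) {..<k})
      (\<lambda>x. \<lambda>i\<in>{..<k}. x)"
    by (auto simp: continuous_map_componentwise)
  from continuous_map_compose[OF this T] have "continuous_on UNIV P"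
    by (simp add: o_def P[abs_def])
  then show ?thesis
    by (rule continuous_on_subset) simp
qed

lemma linear_complex_times:
  assumes "Vector_Spaces.linear (*s) (*) (f :: complex ^ 'N \<Rightarrow> complex)"
  shows "Vector_Spaces.linear (*s) (*) (\<lambda>v. c * f v)"
proof -
  interpret f: Vector_Spaces.linear "(*s)" "(*)" f by (rule assms)
  show ?thesis
    by unfold_locales (simp_all add: f.add f.scale algebra_simps)
qed

lemma continuous_map_prod_field:
  fixes f :: "'b \<Rightarrow> 'i \<Rightarrow> 'a :: real_normed_field"
  assumes "\<And>i. i \<in> I \<Longrightarrow> continuous_map X euclidean (\<lambda>x. f x i)"
  shows "continuous_map X euclidean (\<lambda>x. \<Prod>i\<in>I. f x i)"
  using assms by (simp add: continuous_map_atin tendsto_prod)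

text \<open>These are the extremal polynomials for optimality; the underlying form multiplies the
  \<open>c\<close>-th coordinates of all slots.\<close>

lemma homogeneous_polynomial_coordinate_power:
  "homogeneous_polynomial k (\<lambda>x :: complex ^ 'N. (x $ c) ^ k)"
proof -
  define T where "T = (\<lambda>x :: nat \<Rightarrow> complex ^ 'N. \<Prod>l<k. x l $ c)"
  have "Vector_Spaces.linear (*s) (*) (\<lambda>v. T (x(i := v)))" if "i < k" for x i
  proof -
    have "T (x(i := v)) = (\<Prod>l\<in>{..<k} - {i}. x l $ c) * v $ c" for v
      using that by (simp add: T_def prod.remove[of "{..<k}" i] mult.commute)
    moreover have "Vector_Spaces.linear (*s) (*) (\<lambda>v :: complex ^ 'N. v $ c)"
      by unfold_locales (simp_all add: algebra_simps)
    ultimately show ?thesis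
      using linear_complex_times[of "\<lambda>v. v $ c"] by simp
  qed
  moreover have "continuous_map (product_topology (\<lambda>_. euclidean) {..<k}) euclidean T"
  proof -
    have "continuous_map (product_topology (\<lambda>_. euclidean) {..<k}) euclidean
        (\<lambda>x :: nat \<Rightarrow> complex ^ 'N. x l $ c)" if "l < k" for l
    proof -
      have "continuous_map (product_topology (\<lambda>_. euclidean) {..<k}) euclidean
          (\<lambda>x :: nat \<Rightarrow> complex ^ 'N. x l)"
        using that by (intro continuous_map_product_projection) auto
      moreover have "continuous_map euclidean euclidean (\<lambda>v :: complex ^ 'N. v $ c)"
        by (auto intro!: continuous_intros)
      ultimately show ?thesis
        by (rule continuous_map_compose[unfolded o_def])
    qed
    then show ?thesis
      unfolding T_def by (intro continuous_map_prod_field) auto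
  qed
  ultimately have "continuous_multilinear k T"
    by (simp add: continuous_multilinear_def)
  then show ?thesis
    unfolding homogeneous_polynomial_def by (intro exI[of _ T]) (simp add: T_def)
qed

section \<open>The p-norm, its compact unit sphere, and polynomial norms as attained maxima\<close>

lemma lp_norm_nonneg: "0 \<le> lp_norm p x"
  by (simp add: lp_norm_def)

lemma lp_norm_powr:
  assumes "p > 0"
  shows "lp_norm p x powr p = (\<Sum>j\<in>UNIV. cmod (x $ j) powr p)"
  using assms by (simp add: lp_norm_def powr_powr sum_nonneg)

lemma lp_norm_scale:
  assumes "p > 0"
  shows "lp_norm p (c *s x) = cmod c * lp_norm p x"
  using assms
  by (simp add: lp_norm_def norm_mult powr_mult sum_nonneg powr_powr flip: sum_distrib_left)

lemma lp_norm_eq_0: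
  assumes "p > 0" "lp_norm p x = 0"
  shows "x = 0"
  using assms by (auto simp: lp_norm_def vec_eq_iff sum_nonneg_eq_0_iff)

lemma lp_norm_axis:
  assumes "p > 0"
  shows "lp_norm p (axis c 1) = 1"
proof -
  have "(\<Sum>j\<in>UNIV. cmod (axis c 1 $ j) powr p) = (\<Sum>j\<in>UNIV. if j = c then 1 else 0)"
    by (intro sum.cong) (auto simp: axis_def)
  then show ?thesis by (simp add: lp_norm_def)
qed

lemma continuous_on_lp_norm:
  assumes "p > 0"
  shows "continuous_on S (lp_norm p)"
  unfolding lp_norm_def using assms
  by (intro continuous_on_powr' continuous_intros) (auto simp: sum_nonneg)

text \<open>Compactness makes the supremum in \<open>poly_norm\<close> finite and attained.
  Boundedness needs only that each coordinate of a unit vector has modulus at most 1.\<close>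

lemma compact_lp_sphere:
  fixes p :: real
  assumes "p > 0"
  shows "compact {z :: complex ^ 'N. lp_norm p z = 1}"
proof -
  have "closed {z :: complex ^ 'N. lp_norm p z = 1}"
    using continuous_on_lp_norm[OF assms] by (intro closed_Collect_eq) auto
  moreover have "norm z \<le> CARD('N)" if "lp_norm p z = 1" for z :: "complex ^ 'N"
  proof -
    have "cmod (z $ j) \<le> 1" for j
    proof -
      have "cmod (z $ j) powr p \<le> (\<Sum>j\<in>UNIV. cmod (z $ j) powr p)"
        by (intro member_le_sum) auto
      also have "\<dots> = 1"
        using lp_norm_powr[OF assms, of z] that by simp
      finally show ?thesis
        using assms gr_one_powr[of "cmod (z $ j)" p] by (meson leD leI)
    qed
    then have "(\<Sum>j\<in>UNIV. norm (z $ j)) \<le> CARD('N)"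
      using sum_bounded_above[of UNIV "\<lambda>j. norm (z $ j)" 1] by simp
    then show ?thesis
      using L2_set_le_sum[of UNIV "\<lambda>j. norm (z $ j)"]
      by (simp add: norm_vec_def)
  qed
  then have "bounded {z :: complex ^ 'N. lp_norm p z = 1}"
    by (auto simp: bounded_iff)
  ultimately show ?thesis
    by (simp add: compact_eq_bounded_closed)
qed

lemma cmod_le_poly_norm:
  assumes "p > 0" "continuous_on UNIV P" "lp_norm p z = 1"
  shows "cmod (P z) \<le> poly_norm p P"
proof -
  have "continuous_on {z. lp_norm p z = 1} (\<lambda>z. cmod (P z))"
    using assms(2) by (auto intro: continuous_intros continuous_on_subset)
  then have "bdd_above ((\<lambda>z. cmod (P z)) ` {z. lp_norm p z = 1})"
    by (intro bounded_imp_bdd_above compact_imp_bounded compact_continuous_image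
        compact_lp_sphere assms)
  then show ?thesis
    unfolding poly_norm_def using assms by (intro cSUP_upper) auto
qed

lemma poly_norm_attained:
  assumes "p > 0" "continuous_on UNIV P"
  obtains z where "lp_norm p z = 1" "poly_norm p P = cmod (P z)"
proof -
  let ?S = "{z :: complex ^ 'N. lp_norm p z = 1}"
  have "continuous_on ?S (\<lambda>z. cmod (P z))"
    using assms(2) by (auto intro: continuous_intros continuous_on_subset)
  moreover have ne: "?S \<noteq> {}"
    using lp_norm_axis[OF assms(1)] by blast
  ultimately obtain z where z: "z \<in> ?S" "\<forall>y\<in>?S. cmod (P y) \<le> cmod (P z)"
    using continuous_attains_sup compact_lp_sphere[OF assms(1)] by blast
  then have "poly_norm p P \<le> cmod (P z)"
    unfolding poly_norm_def using ne by (intro cSUP_least) auto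
  with cmod_le_poly_norm[OF assms, of z] z that show ?thesis by fastforce
qed

text \<open>The norm bound is applied to \<open>x\<close> divided by its p-norm, and homogeneity
  restores that factor with the total degree as exponent.\<close>

lemma prod_homogeneous_bound:
  assumes p: "p > 0" and hom: "\<And>i. i \<in> I \<Longrightarrow> homogeneous_polynomial (k i) (P i)"
    and pos: "sum k I > 0"
  shows "(\<Prod>i\<in>I. cmod (P i x)) \<le> poly_norm p (\<lambda>x. \<Prod>i\<in>I. P i x) * lp_norm p x ^ sum k I"
proof (cases "x = 0")
  case True
  \<comment> \<open>A positive sum provides a positive degree, whose polynomial vanishes at 0, and
    forces \<open>I\<close> to be finite, since sums over infinite sets are 0.\<close>
  obtain i where i: "i \<in> I" "k i > 0" "finite I"
    using pos by (metis gr0I sum.infinite sum.neutral less_irrefl)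
  have "P i x = 0"
    using homogeneous_polynomial_scale[OF hom[OF i(1)], of 0 x] i True by (simp add: zero_power)
  then have "(\<Prod>i\<in>I. cmod (P i x)) = 0"
    using i by (auto intro: prod_zero)
  moreover have "lp_norm p x = 0"
    using lp_norm_scale[OF p, of 0 0] True by simp
  ultimately show ?thesis using pos by (simp add: zero_power)
next
  case False
  define s where "s = lp_norm p x"
  have s: "s > 0"
    using lp_norm_eq_0[OF p, of x] lp_norm_nonneg[of p x] False by (auto simp: s_def less_le)
  define z where "z = (1 / complex_of_real s) *s x"
  have x: "x = complex_of_real s *s z"
    using s by (simp add: z_def)
  have z: "lp_norm p z = 1"
    unfolding z_def lp_norm_scale[OF p] using s by (simp add: s_def norm_divide)
  have "(\<Prod>i\<in>I. cmod (P i x)) = (\<Prod>i\<in>I. s ^ k i * cmod (P i z))"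
    unfolding x using homogeneous_polynomial_scale[OF hom] s
    by (intro prod.cong) (auto simp: norm_mult norm_power)
  also have "\<dots> = s ^ sum k I * cmod (\<Prod>i\<in>I. P i z)"
    by (simp add: prod.distrib power_sum prod_norm)
  also have "\<dots> \<le> s ^ sum k I * poly_norm p (\<lambda>x. \<Prod>i\<in>I. P i x)"
    using s z p hom homogeneous_polynomial_continuous
    by (intro mult_left_mono cmod_le_poly_norm continuous_on_prod) auto
  finally show ?thesis by (simp add: s_def mult.commute)
qed

section \<open>Concavity inequalities for real powers\<close>

lemma powr_sum_subadditive:
  fixes q :: real
  assumes "finite J" "0 < q" "q \<le> 1" "\<And>j. j \<in> J \<Longrightarrow> 0 \<le> a j"
  shows "(\<Sum>j\<in>J. a j) powr q \<le> (\<Sum>j\<in>J. a j powr q)"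
proof (cases "(\<Sum>j\<in>J. a j) = 0")
  case True
  then show ?thesis by (simp add: sum_nonneg)
next
  case False
  define A where "A = (\<Sum>j\<in>J. a j)"
  have A: "A > 0"
    using False assms by (simp add: A_def less_le sum_nonneg)
  \<comment> \<open>One factor \<open>A\<close> is split off and distributed. Since
    \<open>q - 1 <= 0\<close>, replacing the remaining \<open>A\<close> by the smaller
    \<open>a j\<close> in each term can only enlarge it.\<close>
  have "A powr q = (\<Sum>j\<in>J. a j) * A powr (q - 1)"
    using A by (simp add: powr_diff flip: A_def)
  also have "\<dots> = (\<Sum>j\<in>J. a j * A powr (q - 1))"
    by (simp add: sum_distrib_right)
  also have "\<dots> \<le> (\<Sum>j\<in>J. a j powr q)"
  proof (intro sum_mono)
    fix j assume j: "j \<in> J"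
    show "a j * A powr (q - 1) \<le> a j powr q"
    proof (cases "a j = 0")
      case False
      with assms j have aj: "a j > 0" by (simp add: less_le)
      have "a j \<le> A"
        unfolding A_def using assms j by (intro member_le_sum) auto
      then have "A powr (q - 1) \<le> a j powr (q - 1)"
        using aj assms by (intro powr_mono2') auto
      then have "a j * A powr (q - 1) \<le> a j * a j powr (q - 1)"
        using aj by simp
      also have "\<dots> = a j powr q"
        using aj by (simp add: powr_diff)
      finally show ?thesis .
    qed simp
  qed
  finally show ?thesis by (simp add: A_def)
qed

lemma powr_le_tangent:
  fixes q :: real
  assumes "0 < q" "q \<le> 1" "0 < S" "0 \<le> s"
  shows "s powr q \<le> S powr q + q * S powr (q - 1) * (s - S)"
proof (cases "s = 0")
  case True
  have "S * S powr (q - 1) = S powr q"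
    using assms by (simp add: powr_diff)
  then show ?thesis
    using True assms mult_left_le_one_le[of "S powr q" q] by (simp add: algebra_simps)
next
  case False
  \<comment> \<open>Weighted AM-GM for \<open>s\<close> and \<open>S\<close> with weights
    \<open>q\<close> and \<open>1 - q\<close>; multiplication by \<open>S powr (q - 1)\<close> turns
    it into the tangent bound.\<close>
  have "s powr q * S powr (1 - q) \<le> q * s + (1 - q) * S"
    using assms False by (intro Youngs_inequality_0) auto
  then have "s powr q * S powr (1 - q) * S powr (q - 1) \<le> (q * s + (1 - q) * S) * S powr (q - 1)"
    by (intro mult_right_mono) auto
  moreover have "S powr (1 - q) * S powr (q - 1) = 1"
    using assms by (simp flip: powr_add)
  moreover have "S * S powr (q - 1) = S powr q"
    using assms by (simp add: powr_diff)
  moreover have "q * s * S powr (q - 1) + (1 - q) * (S * S powr (q - 1))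
      = (q * s + (1 - q) * S) * S powr (q - 1)"
    by (simp add: algebra_simps)
  ultimately have "s powr q \<le> q * s * S powr (q - 1) + (1 - q) * S powr q"
    by (simp add: mult.assoc)
  with \<open>S * S powr (q - 1) = S powr q\<close> show ?thesis
    by (simp add: algebra_simps)
qed

section \<open>Maximum principle and elimination of the unimodular variables\<close>

lemma norm_at_0_le_if_exp_bound:
  assumes "F holomorphic_on UNIV"
    and "\<And>t. cmod t = 1 \<Longrightarrow> cmod (F t) \<le> C * exp (Re (b * t))"
  shows "cmod (F 0) \<le> C"
proof -
  \<comment> \<open>The growth factor is the modulus of the zero-free function
    \<open>exp (b * t)\<close>. Dividing by it keeps holomorphy, leaves the constant bound
    \<open>C\<close> on the circle and does not change the value at 0.\<close>
  define G where "G = (\<lambda>t. F t * exp (- (b * t)))"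
  have hol: "G holomorphic_on UNIV"
    unfolding G_def by (intro holomorphic_intros assms)
  have "cmod (G t) \<le> C" if "t \<in> frontier (cball 0 1)" for t
  proof -
    have "cmod t = 1" using that by simp
    have "cmod (G t) = cmod (F t) * exp (- Re (b * t))"
      unfolding G_def norm_mult norm_exp_eq_Re by simp
    also have "\<dots> \<le> C * exp (Re (b * t)) * exp (- Re (b * t))"
      using assms(2)[OF \<open>cmod t = 1\<close>] by (intro mult_right_mono) auto
    also have "\<dots> = C"
      by (simp add: mult.assoc flip: exp_add)
    finally show ?thesis .
  qed
  then have "cmod (G 0) \<le> C"
    using hol
    by (intro maximum_modulus_frontier[of G "cball 0 1" C 0] holomorphic_on_imp_continuous_on)
      (auto intro: holomorphic_on_subset)
  then show ?thesis by (simp add: G_def)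
qed

lemma holomorphic_cnj_cnj:
  assumes "f holomorphic_on UNIV"
  shows "(\<lambda>t. cnj (f (cnj t))) holomorphic_on UNIV"
  using holomorphic_on_compose_cnj_cnj[of f UNIV] assms
  by (auto simp: o_def intro: holomorphic_on_subset)

text \<open>Induction removes one \<open>t m\<close> at a time: the factor \<open>P m\<close> gets
  frozen at \<open>y m\<close> and its modulus is moved into \<open>C\<close>, which is therefore
  generalised. The diagonal terms of the exponent cancel because \<open>cmod (t j) = 1\<close>, so
  it is a constant plus a real part linear in \<open>t m\<close>; at the empty index set it is
  0.\<close>

lemma torus_elimination:
  fixes P :: "'i \<Rightarrow> complex ^ 'N \<Rightarrow> complex" and y :: "'i \<Rightarrow> complex ^ 'N"
  assumes "finite I"
    and hom: "\<And>i. i \<in> I \<Longrightarrow> homogeneous_polynomial (k i) (P i)"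
    and bound: "\<And>t. (\<And>j. cmod (t j) = 1) \<Longrightarrow>
      (\<Prod>i\<in>I. cmod (P i (\<Sum>j\<in>I. t j *s y j)))
        \<le> C * exp (\<Sum>c\<in>UNIV. w c * ((cmod (\<Sum>j\<in>I. t j * y j $ c))\<^sup>2 - (\<Sum>j\<in>I. (cmod (y j $ c))\<^sup>2)))"
  shows "(\<Prod>i\<in>I. cmod (P i (y i))) \<le> C"
  using assms
proof (induction I arbitrary: C rule: finite_induct)
  case empty
  show ?case using empty(2)[of "\<lambda>_. 1"] by simp
next
  case (insert m J)
  define D where "D = cmod (P m (y m))"
  \<comment> \<open>This is the premise of the induction hypothesis for the bound
    \<open>C / D\<close>, multiplied out so that \<open>D = 0\<close> is still allowed.\<close>
  have J: "(\<Prod>i\<in>J. cmod (P i (\<Sum>j\<in>J. t j *s y j))) * D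
        \<le> C * exp (\<Sum>c\<in>UNIV. w c * ((cmod (\<Sum>j\<in>J. t j * y j $ c))\<^sup>2 - (\<Sum>j\<in>J. (cmod (y j $ c))\<^sup>2)))"
      (is "_ \<le> C * exp ?E")
    if t: "\<And>j. cmod (t j) = 1" for t
  proof -
    define v where "v = (\<Sum>j\<in>J. t j *s y j)"
    \<comment> \<open>The coefficient of \<open>s\<close> in the cross terms between
      \<open>v\<close> and \<open>s *s y m\<close>, weighted by \<open>w\<close>.\<close>
    define b where "b = (\<Sum>c\<in>UNIV. 2 * complex_of_real (w c) * cnj (v $ c) * y m $ c)"
    have vc: "v $ c = (\<Sum>j\<in>J. t j * y j $ c)" for c
      by (simp add: v_def)
    \<comment> \<open>On the unit circle the conjugated factor has the modulus of \<open>P m (v + s *s y m)\<close>,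
      but its value at 0 is the conjugate of the coefficient of \<open>s ^ k m\<close> there.\<close>
    define F where "F = (\<lambda>s. (\<Prod>i\<in>J. P i (v + s *s y m)) * cnj (P m (y m + cnj s *s v)))"
    have "F holomorphic_on UNIV"
      unfolding F_def using insert.prems
      by (intro holomorphic_intros
          holomorphic_cnj_cnj[of "\<lambda>s. P m (y m + s *s v)"]
          homogeneous_polynomial_line_holomorphic) auto
    moreover have "cmod (F s) \<le> C * exp ?E * exp (Re (b * s))" if s: "cmod s = 1" for s
    proof -
      let ?t = "t(m := s)"
      have x: "(\<Sum>j\<in>insert m J. ?t j *s y j) = v + s *s y m"
      proof -
        have "(\<Sum>j\<in>J. ?t j *s y j) = v"
          unfolding v_def using insert.hyps by (intro sum.cong) auto
        then show ?thesis using insert.hyps by (simp add: add.commute)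
      qed
      have xc: "(\<Sum>j\<in>insert m J. ?t j * y j $ c) = v $ c + s * y m $ c" for c
        using arg_cong[OF x, of "\<lambda>x. x $ c"] by simp
      \<comment> \<open>As \<open>cnj s\<close> inverts \<open>s\<close>, the two arguments of
        \<open>P m\<close> differ by a unimodular scalar, which homogeneity makes invisible to the
        modulus.\<close>
      have "cnj s * s = 1"
        using s complex_norm_square[of s] by (simp add: mult.commute)
      then have "y m + cnj s *s v = cnj s *s (v + s *s y m)"
        by (simp add: vec.scale_right_distrib vector_smult_assoc add.commute)
      then have Pm: "cmod (P m (y m + cnj s *s v)) = cmod (P m (v + s *s y m))"
        using homogeneous_polynomial_scale[OF insert.prems(1)[OF insertI1], of "cnj s" "v + s *s y m"] s
        by (simp only: complex_mod_cnj power_one mult_1_left norm_mult norm_power)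
      \<comment> \<open>The square of \<open>s * y m $ c\<close> has the modulus of the newly
        inserted summand and cancels it; only the cross term is new.\<close>
      have quad: "(cmod (v $ c + s * y m $ c))\<^sup>2 - (\<Sum>j\<in>insert m J. (cmod (y j $ c))\<^sup>2)
          = (cmod (v $ c))\<^sup>2 - (\<Sum>j\<in>J. (cmod (y j $ c))\<^sup>2) + Re (2 * cnj (v $ c) * y m $ c * s)" for c
      proof -
        have "(cmod (v $ c + s * y m $ c))\<^sup>2
            = (cmod (v $ c))\<^sup>2 + (cmod (s * y m $ c))\<^sup>2 + 2 * Re (cnj (v $ c) * (s * y m $ c))"
          by (simp only: cmod_power2) (simp add: power2_eq_square algebra_simps)
        then show ?thesis
          using insert.hyps s by (simp add: norm_mult algebra_simps)
      qed
      have "cmod (F s) = (\<Prod>i\<in>insert m J. cmod (P i (\<Sum>j\<in>insert m J. ?t j *s y j)))"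
        unfolding x using insert.hyps Pm by (simp add: F_def norm_mult prod_norm mult.commute)
      also have "\<dots> \<le> C * exp (\<Sum>c\<in>UNIV. w c * ((cmod (v $ c + s * y m $ c))\<^sup>2 - (\<Sum>j\<in>insert m J. (cmod (y j $ c))\<^sup>2)))"
        using insert.prems(2)[of ?t] t s unfolding xc by simp
      also have "(\<Sum>c\<in>UNIV. w c * ((cmod (v $ c + s * y m $ c))\<^sup>2 - (\<Sum>j\<in>insert m J. (cmod (y j $ c))\<^sup>2)))
          = ?E + Re (b * s)"
      proof -
        have "Re (b * s) = (\<Sum>c\<in>UNIV. w c * Re (2 * cnj (v $ c) * y m $ c * s))"
          unfolding b_def sum_distrib_right Re_sum
          by (intro sum.cong refl) (simp add: algebra_simps)
        then show ?thesis
          by (simp only: quad distrib_left sum.distrib flip: vc)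
      qed
      finally show ?thesis by (simp only: exp_add mult.assoc)
    qed
    ultimately have "cmod (F 0) \<le> C * exp ?E"
      by (rule norm_at_0_le_if_exp_bound)
    then show ?thesis
      by (simp add: F_def D_def norm_mult prod_norm v_def)
  qed
  show ?case
  proof (cases "D = 0")
    case True
    \<comment> \<open>The product is 0 here, and \<open>J\<close> at \<open>t = 1\<close> still
      gives \<open>0 <= C\<close>.\<close>
    then show ?thesis
      using J[of "\<lambda>_. 1"] insert.hyps by (simp add: D_def zero_le_mult_iff)
  next
    case False
    then have "D > 0" by (simp add: D_def)
    then have "(\<Prod>i\<in>J. cmod (P i (y i))) \<le> C / D"
      using J insert.prems(1) by (intro insert.IH) (auto simp: field_simps)
    then show ?thesis
      using \<open>D > 0\<close> insert.hyps by (simp add: D_def field_simps)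
  qed
qed

section \<open>Control of the p-norm by second moments, and of powers by exponentials\<close>

lemma lp_norm_powr_le_second_moments:
  fixes p :: real and y :: "'i \<Rightarrow> complex ^ 'N"
  assumes p: "1 \<le> p" "p \<le> 2" and "finite I" and y: "(\<Sum>j\<in>I. lp_norm p (y j) powr p) \<le> 1"
    and S: "\<And>c. S c = (\<Sum>j\<in>I. (cmod (y j $ c))\<^sup>2)"
    and x: "x = (\<Sum>j\<in>I. t j *s y j)"
  shows "lp_norm p x powr p
    \<le> 1 + (\<Sum>c\<in>UNIV. (p / 2) * S c powr (p / 2 - 1) * ((cmod (x $ c))\<^sup>2 - S c))"
proof -
  have sq: "a powr p = (a\<^sup>2) powr (p / 2)" if "a \<ge> 0" for a :: real
    using that p by (simp add: powr_powr flip: powr_numeral)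
  have "lp_norm p x powr p = (\<Sum>c\<in>UNIV. cmod (x $ c) powr p)"
    using p by (simp add: lp_norm_powr)
  also have "\<dots> \<le> (\<Sum>c\<in>UNIV. S c powr (p / 2)
      + (p / 2) * S c powr (p / 2 - 1) * ((cmod (x $ c))\<^sup>2 - S c))"
  proof (intro sum_mono)
    fix c
    show "cmod (x $ c) powr p \<le> S c powr (p / 2)
      + (p / 2) * S c powr (p / 2 - 1) * ((cmod (x $ c))\<^sup>2 - S c)"
    proof (cases "S c = 0")
      case True
      \<comment> \<open>There is no tangent at 0, but every \<open>y j\<close> and hence
        \<open>x\<close> vanishes in this coordinate, and \<open>0 powr a = 0\<close> for every
        exponent.\<close>
      then have "\<forall>j\<in>I. y j $ c = 0"
        using \<open>finite I\<close> by (simp add: S sum_nonneg_eq_0_iff)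
      then have "x $ c = 0" by (simp add: x)
      then show ?thesis using True by simp
    next
      case False
      then have "S c > 0" by (simp add: S less_le sum_nonneg)
      then show ?thesis
        unfolding sq[OF norm_ge_zero] using p by (intro powr_le_tangent) auto
    qed
  qed
  also have "\<dots> = (\<Sum>c\<in>UNIV. S c powr (p / 2))
      + (\<Sum>c\<in>UNIV. (p / 2) * S c powr (p / 2 - 1) * ((cmod (x $ c))\<^sup>2 - S c))"
    by (rule sum.distrib)
  \<comment> \<open>Subadditivity with exponent \<open>p / 2 <= 1\<close> bounds the constant terms
    by the total p-mass of the \<open>y j\<close>.\<close>
  also have "(\<Sum>c\<in>UNIV. S c powr (p / 2)) \<le> (\<Sum>c\<in>UNIV. \<Sum>j\<in>I. cmod (y j $ c) powr p)"
    unfolding sq[OF norm_ge_zero] S using p \<open>finite I\<close>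
    by (intro sum_mono powr_sum_subadditive) auto
  also have "\<dots> = (\<Sum>j\<in>I. lp_norm p (y j) powr p)"
    using p by (subst sum.swap) (simp add: lp_norm_powr)
  also note y
  finally show ?thesis by simp
qed

text \<open>This is \<open>ln u <= u - 1\<close> at \<open>u = a powr p\<close>, multiplied by
  \<open>m / p\<close> and exponentiated, with equality at \<open>a = 1\<close>. It replaces powers
  of \<open>a\<close> by exponentials of \<open>a powr p\<close>, which is additive over
  coordinates.\<close>

lemma power_le_exp_powr:
  fixes p :: real
  assumes "p > 0" "a \<ge> 0" "m > 0"
  shows "a ^ m \<le> exp (m / p * (a powr p - 1))"
proof (cases "a = 0")
  case False
  then have a: "a > 0" using assms by simp
  have "p * ln a \<le> a powr p - 1"
    using ln_le_minus_one[of "a powr p"] a by (simp add: ln_powr)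
  then have "m / p * (p * ln a) \<le> m / p * (a powr p - 1)"
    using assms by (intro mult_left_mono) auto
  then have "m * ln a \<le> m / p * (a powr p - 1)"
    using assms by simp
  moreover have "a ^ m = exp (m * ln a)"
    using a by (simp add: exp_of_nat_mult)
  ultimately show ?thesis by simp
qed (use assms in \<open>simp add: zero_power\<close>)

section \<open>The constant as a product of radii, and the lower bound for products\<close>

lemma power_powr_commute:
  fixes a :: real
  assumes "a > 0"
  shows "(a ^ m) powr q = (a powr q) ^ m"
  using assms by (simp add: powr_powr mult.commute flip: powr_realpow)

text \<open>With \<open>K\<close> the total degree, \<open>K ^ K\<close> splits into the factors
  \<open>K ^ k i\<close>. The bases on the right are the radii \<open>r i\<close> of both halves of
  the theorem.\<close>

lemma product_const_eq:
  assumes "\<forall>i\<in>{1..n}. k i \<ge> 1"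
  shows "product_const p n k
    = (\<Prod>i=1..n. ((real (k i) / real (\<Sum>i=1..n. k i)) powr (1 / p)) ^ k i)"
proof -
  let ?K = "\<Sum>i=1..n. k i"
  have "(\<Prod>i=1..n. real (k i) ^ k i) / real ?K ^ ?K = (\<Prod>i=1..n. (real (k i) / real ?K) ^ k i)"
    by (simp add: power_divide prod_dividef power_sum)
  then have "product_const p n k = (\<Prod>i=1..n. ((real (k i) / real ?K) ^ k i) powr (1 / p))"
    by (simp add: product_const_def prod_powr_distrib)
  also have "\<dots> = (\<Prod>i=1..n. ((real (k i) / real ?K) powr (1 / p)) ^ k i)"
  proof (intro prod.cong refl)
    fix i assume i: "i \<in> {1..n}"
    then have "k i \<ge> 1" "k i \<le> ?K" using assms by (auto intro: member_le_sum)
    then have a: "real (k i) / real ?K > 0" by (intro divide_pos_pos; linarith)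
    show "((real (k i) / real ?K) ^ k i) powr (1 / p) = ((real (k i) / real ?K) powr (1 / p)) ^ k i"
      using a by (rule power_powr_commute)
  qed
  finally show ?thesis .
qed

lemma poly_norm_prod_ge:
  fixes P :: "nat \<Rightarrow> complex ^ 'N \<Rightarrow> complex"
  assumes p: "1 \<le> p" "p \<le> 2" and n: "n \<ge> 1" and k: "\<forall>i\<in>{1..n}. k i \<ge> 1"
    and hom: "\<forall>i\<in>{1..n}. homogeneous_polynomial (k i) (P i)"
  shows "product_const p n k * (\<Prod>i=1..n. poly_norm p (P i)) \<le> poly_norm p (\<lambda>x. \<Prod>i=1..n. P i x)"
proof -
  define K where "K = (\<Sum>i=1..n. k i)"
  define M where "M = poly_norm p (\<lambda>x. \<Prod>i=1..n. P i x)"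
  have "k 1 \<le> K" unfolding K_def using n by (intro member_le_sum) auto
  then have K: "K > 0" using k n by force
  have "\<exists>z. \<forall>i\<in>{1..n}. lp_norm p (z i) = 1 \<and> poly_norm p (P i) = cmod (P i (z i))"
  proof (intro bchoice ballI)
    fix i assume "i \<in> {1..n}"
    with hom have "continuous_on UNIV (P i)"
      using homogeneous_polynomial_continuous by blast
    from poly_norm_attained[OF _ this, of p] p
    show "\<exists>z. lp_norm p z = 1 \<and> poly_norm p (P i) = cmod (P i z)" by auto
  qed
  then obtain z where z: "\<And>i. i \<in> {1..n} \<Longrightarrow> lp_norm p (z i) = 1"
      "\<And>i. i \<in> {1..n} \<Longrightarrow> poly_norm p (P i) = cmod (P i (z i))"
    by blast
  \<comment> \<open>These radii maximise the product of the \<open>r i ^ k i\<close> when the sum of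
    the \<open>r i powr p\<close> is 1.\<close>
  define r where "r = (\<lambda>i. (real (k i) / real K) powr (1 / p))"
  define y where "y = (\<lambda>i. complex_of_real (r i) *s z i)"
  have r0: "r i \<ge> 0" for i by (simp add: r_def)
  have "lp_norm p (y i) powr p = real (k i) / real K" if "i \<in> {1..n}" for i
    using p that by (simp add: y_def lp_norm_scale z r_def powr_powr)
  then have y: "(\<Sum>j=1..n. lp_norm p (y j) powr p) \<le> 1"
    using K by (simp add: K_def flip: sum_divide_distrib of_nat_sum)
  define S where "S = (\<lambda>c. \<Sum>j=1..n. (cmod (y j $ c))\<^sup>2)"
  \<comment> \<open>The slope of the tangent at \<open>S c\<close>, times the factor
    \<open>K / p\<close> produced by \<open>power_le_exp_powr\<close>.\<close>
  define w where "w = (\<lambda>c. real K / p * ((p / 2) * S c powr (p / 2 - 1)))"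
  \<comment> \<open>Some unit vector exists, so \<open>M\<close> dominates a modulus; its sign is
    needed to multiply estimates by \<open>M\<close>.\<close>
  obtain z0 :: "complex ^ 'N" where "lp_norm p z0 = 1"
    using lp_norm_axis p by (metis less_le_trans zero_less_one)
  then have M0: "M \<ge> 0"
    unfolding M_def using p homogeneous_polynomial_continuous[OF bspec[OF hom]]
    by (intro order_trans[OF norm_ge_zero cmod_le_poly_norm[of _ _ z0]] continuous_on_prod) auto
  have "(\<Prod>i=1..n. cmod (P i (y i))) \<le> M"
  proof (rule torus_elimination)
    fix t :: "nat \<Rightarrow> complex"
    define x where "x = (\<Sum>j=1..n. t j *s y j)"
    have "(\<Prod>i=1..n. cmod (P i x)) \<le> M * lp_norm p x ^ K"
      unfolding M_def K_def using p hom K by (intro prod_homogeneous_bound) (auto simp: K_def)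
    \<comment> \<open>The vector \<open>x\<close> may lie off the unit sphere; its norm is absorbed
      into an exponential of the form that \<open>torus_elimination\<close> accepts.\<close>
    also have "lp_norm p x ^ K \<le> exp (K / p * (lp_norm p x powr p - 1))"
      using p K by (intro power_le_exp_powr) (auto simp: lp_norm_nonneg)
    also have "K / p * (lp_norm p x powr p - 1)
        \<le> K / p * (\<Sum>c\<in>UNIV. (p / 2) * S c powr (p / 2 - 1) * ((cmod (x $ c))\<^sup>2 - S c))"
      using lp_norm_powr_le_second_moments[OF p _ y S_def[THEN fun_cong] x_def] p
      by (intro mult_left_mono) auto
    also have "\<dots> = (\<Sum>c\<in>UNIV. w c * ((cmod (x $ c))\<^sup>2 - S c))"
      by (simp only: w_def sum_distrib_left mult.assoc)
    finally show "(\<Prod>i=1..n. cmod (P i (\<Sum>j=1..n. t j *s y j)))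
        \<le> M * exp (\<Sum>c\<in>UNIV. w c * ((cmod (\<Sum>j=1..n. t j * y j $ c))\<^sup>2 - (\<Sum>j=1..n. (cmod (y j $ c))\<^sup>2)))"
      using M0 by (simp add: x_def S_def mult_left_mono)
  qed (use hom in auto)
  \<comment> \<open>Homogeneity extracts the radii and leaves the norms attained at the
    \<open>z i\<close>.\<close>
  also have "(\<Prod>i=1..n. cmod (P i (y i))) = (\<Prod>i=1..n. r i ^ k i * poly_norm p (P i))"
    using homogeneous_polynomial_scale[OF bspec[OF hom]] r0
    by (intro prod.cong refl) (simp add: y_def z norm_mult norm_power)
  finally show ?thesis
    using product_const_eq[OF k] by (simp add: M_def prod.distrib r_def K_def)
qed

section \<open>Optimality, from powers of distinct coordinates\<close>

lemma coordinate_powers_bound: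
  assumes p: "p > 0" and k: "\<forall>i\<in>{1..n}. k i \<ge> 1" and e: "inj_on e {1..n}"
    and x: "lp_norm p x = 1"
  shows "cmod (\<Prod>i=1..n. (x $ e i) ^ k i) \<le> product_const p n k"
proof -
  define K where "K = (\<Sum>i=1..n. k i)"
  define b where "b = (\<lambda>i. cmod (x $ e i) powr p)"
  define r where "r = (\<lambda>i. (real (k i) / real K) powr (1 / p))"
  have "(\<Sum>i=1..n. b i) = (\<Sum>c\<in>e ` {1..n}. cmod (x $ c) powr p)"
    using e by (simp add: sum.reindex b_def)
  also have "\<dots> \<le> (\<Sum>c\<in>UNIV. cmod (x $ c) powr p)"
    by (intro sum_mono2) auto
  also have "\<dots> = 1"
    using lp_norm_powr[OF p, of x] x by simp
  finally have b: "(\<Sum>i=1..n. b i) \<le> 1" .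
  have "cmod (x $ e i) ^ k i \<le> r i ^ k i * exp ((K * b i - k i) / p)" if i: "i \<in> {1..n}" for i
  proof -
    have "k i \<ge> 1" "k i \<le> K" using k i by (auto simp: K_def intro: member_le_sum)
    then have pos: "real (k i) > 0" "real K > 0" by auto
    then have r: "r i > 0" by (simp add: r_def)
    \<comment> \<open>Dividing by \<open>r i\<close> puts the equality case of
      \<open>power_le_exp_powr\<close> at the expected maximum \<open>b i = k i / K\<close>.\<close>
    have "(cmod (x $ e i) / r i) ^ k i \<le> exp (k i / p * ((cmod (x $ e i) / r i) powr p - 1))"
      using p r pos by (intro power_le_exp_powr) auto
    also have "(cmod (x $ e i) / r i) powr p = b i * K / k i"
      using p r pos by (simp add: powr_divide powr_mult b_def r_def powr_powr)
    also have "k i / p * (b i * K / k i - 1) = (K * b i - k i) / p"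
      using p pos by (simp add: field_simps)
    finally show ?thesis
      using r by (simp add: power_divide field_simps)
  qed
  then have "(\<Prod>i=1..n. cmod (x $ e i) ^ k i) \<le> (\<Prod>i=1..n. r i ^ k i * exp ((K * b i - k i) / p))"
    by (intro prod_mono) auto
  \<comment> \<open>The \<open>k i\<close> add up to \<open>K\<close>, so the total exponent has the
    sign of the sum of the \<open>b i\<close> minus 1, which is at most 0.\<close>
  also have "\<dots> = (\<Prod>i=1..n. r i ^ k i) * exp (K * ((\<Sum>i=1..n. b i) - 1) / p)"
    by (simp add: prod.distrib sum_subtractf sum_distrib_left K_def right_diff_distrib
        flip: exp_sum sum_divide_distrib)
  also have "\<dots> \<le> (\<Prod>i=1..n. r i ^ k i) * 1"
    using b p by (intro mult_left_mono prod_nonneg)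
      (auto simp: r_def divide_le_0_iff mult_le_0_iff)
  finally show ?thesis
    using product_const_eq[OF k] by (simp add: r_def K_def norm_power flip: prod_norm)
qed

theorem theorem1p4:
  fixes p :: real and n :: nat and k :: "nat \<Rightarrow> nat"
  assumes "1 \<le> p" and "p \<le> 2" and "n \<ge> 1" and "\<forall>i\<in>{1..n}. k i \<ge> 1"
  shows
    "(\<forall>P :: nat \<Rightarrow> complex ^ 'N \<Rightarrow> complex.
        (\<forall>i\<in>{1..n}. homogeneous_polynomial (k i) (P i)) \<longrightarrow>
        poly_norm p (\<lambda>x. \<Prod>i=1..n. P i x) \<ge> product_const p n k * (\<Prod>i=1..n. poly_norm p (P i)))
     \<and> (CARD('N) \<ge> n \<longrightarrow>
        (\<forall>C > product_const p n k.
          \<not> (\<forall>P :: nat \<Rightarrow> complex ^ 'N \<Rightarrow> complex.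
               (\<forall>i\<in>{1..n}. homogeneous_polynomial (k i) (P i)) \<longrightarrow>
               poly_norm p (\<lambda>x. \<Prod>i=1..n. P i x) \<ge> C * (\<Prod>i=1..n. poly_norm p (P i)))))"
proof (intro conjI allI impI notI)
  fix P :: "nat \<Rightarrow> complex ^ 'N \<Rightarrow> complex"
  assume "\<forall>i\<in>{1..n}. homogeneous_polynomial (k i) (P i)"
  then show "poly_norm p (\<lambda>x. \<Prod>i=1..n. P i x) \<ge> product_const p n k * (\<Prod>i=1..n. poly_norm p (P i))"
    using assms by (intro poly_norm_prod_ge)
next
  fix C
  assume "n \<le> CARD('N)" and C: "C > product_const p n k"
    and ineq: "\<forall>P :: nat \<Rightarrow> complex ^ 'N \<Rightarrow> complex.
       (\<forall>i\<in>{1..n}. homogeneous_polynomial (k i) (P i)) \<longrightarrow>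
       poly_norm p (\<lambda>x. \<Prod>i=1..n. P i x) \<ge> C * (\<Prod>i=1..n. poly_norm p (P i))"
  then obtain e :: "nat \<Rightarrow> 'N" where e: "inj_on e {1..n}"
    using card_le_inj[of "{1..n}" "UNIV :: 'N set"] by auto
  define P where "P = (\<lambda>i (x :: complex ^ 'N). (x $ e i) ^ k i)"
  have hom: "homogeneous_polynomial (k i) (P i)" for i
    unfolding P_def by (rule homogeneous_polynomial_coordinate_power)
  have p: "p > 0" using assms by simp
  \<comment> \<open>The unit vector along coordinate \<open>e i\<close> gives \<open>P i\<close> the
    value 1.\<close>
  have "1 \<le> poly_norm p (P i)" for i
    using cmod_le_poly_norm[OF p homogeneous_polynomial_continuous[OF hom] lp_norm_axis[OF p], of i "e i"]
    by (simp add: P_def)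
  then have "1 \<le> (\<Prod>i=1..n. poly_norm p (P i))"
    by (intro prod_ge_1) auto
  \<comment> \<open>\<open>C\<close> exceeds a real power, which is nonnegative.\<close>
  moreover have "C \<ge> 0"
    using C powr_ge_zero unfolding product_const_def by (meson less_imp_le order_trans)
  ultimately have "C \<le> C * (\<Prod>i=1..n. poly_norm p (P i))"
    by (simp add: mult_le_cancel_left1)
  also have "\<dots> \<le> poly_norm p (\<lambda>x. \<Prod>i=1..n. P i x)"
    using ineq hom by blast
  also have "\<dots> \<le> product_const p n k"
    unfolding poly_norm_def P_def
    using coordinate_powers_bound[OF p assms(4) e] lp_norm_axis[OF p]
    by (intro cSUP_least) auto
  finally show False using C by simp
qed

end
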